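(* Let $n\geq 2$ be an integer. For every positive integer $k$, $$\Phi_k(K_{n,n})=\frac12\binom kn\left(\binom kn-1\right),$$ and for $n+1\leq k\leq 2n$, $$\varphi_k(K_{n,n})=\frac12\binom kn\binom n{k-n}.$$
   Context: $K_{n,n}$ is the complete bipartite graph with both parts of size $n$. A vertex coloring of a graph $G$ (not necessarily proper) is distinguishing if the only automorphism of $G$ preserving the color of every vertex is the identity. Two colorings $c_1,c_2$ of $G$ are equivalent if there is an automorphism $\alpha$ of $G$ with $c_1(v)=c_2(\alpha(v))$ for all $v\in V(G)$. $\Phi_k(G)$ is the number of non-equivalent distinguishing colorings (equivalence classes) of $G$ with $\{1,\dots,k\}$ as the set of admissible colors (not all need be used), and $\varphi_k(G)$ is the number of non-equivalent distinguishing colorings of $G$ with color set $\{1,\dots,k\}$ in which all $k$ colors are used. *)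

theory Defs
  imports Complex_Main "HOL-Library.FuncSet"
begin

text \<open>A finite simple graph is a pair of a vertex set and a set of edges, each edge being a
  two-element set of vertices.\<close>

type_synonym 'a graph = "'a set \<times> 'a set set"

abbreviation verts :: "'a graph \<Rightarrow> 'a set" where "verts G \<equiv> fst G"
abbreviation edges :: "'a graph \<Rightarrow> 'a set set" where "edges G \<equiv> snd G"

definition complete_bipartite :: "nat \<Rightarrow> nat \<Rightarrow> (nat + nat) graph" where
  "complete_bipartite m n =
     ({1..m} <+> {1..n}, {{Inl i, Inr j} | i j. i \<in> {1..m} \<and> j \<in> {1..n}})"

text \<open>Only the values of an automorphism on the vertex set matter; they are not normalised
  outside of it, so ``being the identity'' below always means being the identity on the vertices.\<close>

definition automorphism :: "'a graph \<Rightarrow> ('a \<Rightarrow> 'a) \<Rightarrow> bool" where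
  "automorphism G \<alpha> \<longleftrightarrow>
     bij_betw \<alpha> (verts G) (verts G) \<and>
     (\<forall>u\<in>verts G. \<forall>v\<in>verts G. {u, v} \<in> edges G \<longleftrightarrow> {\<alpha> u, \<alpha> v} \<in> edges G)"

definition distinguishing :: "'a graph \<Rightarrow> ('a \<Rightarrow> nat) \<Rightarrow> bool" where
  "distinguishing G c \<longleftrightarrow>
     (\<forall>\<alpha>. automorphism G \<alpha> \<and> (\<forall>v\<in>verts G. c (\<alpha> v) = c v) \<longrightarrow> (\<forall>v\<in>verts G. \<alpha> v = v))"

text \<open>Colorings are extensional functions on the vertex set, so that two colorings
  are equal exactly if they agree on all vertices.\<close>

definition coloring_equiv :: "'a graph \<Rightarrow> (('a \<Rightarrow> nat) \<times> ('a \<Rightarrow> nat)) set" where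
  "coloring_equiv G =
     {(c1, c2). c1 \<in> extensional (verts G) \<and> c2 \<in> extensional (verts G) \<and>
        (\<exists>\<alpha>. automorphism G \<alpha> \<and> (\<forall>v\<in>verts G. c1 v = c2 (\<alpha> v)))}"

text \<open>Equivalence of colorings preserves the set of colors used and the property of being
  distinguishing, so each class counted below consists entirely of colorings of the given kind.\<close>

definition Phi :: "nat \<Rightarrow> 'a graph \<Rightarrow> nat" where
  "Phi k G =
     card ({c \<in> verts G \<rightarrow>\<^sub>E {1..k}. distinguishing G c} // coloring_equiv G)"

definition phi :: "nat \<Rightarrow> 'a graph \<Rightarrow> nat" where
  "phi k G =
     card ({c \<in> verts G \<rightarrow>\<^sub>E {1..k}. distinguishing G c \<and> c ` verts G = {1..k}}
             // coloring_equiv G)"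

lemma automorphism_id: "automorphism G (\<lambda>v. v)"
  by (auto simp: automorphism_def bij_betw_def)

lemma automorphism_comp:
  assumes "automorphism G \<alpha>" "automorphism G \<beta>"
  shows "automorphism G (\<beta> \<circ> \<alpha>)"
proof -
  have b: "bij_betw \<alpha> (verts G) (verts G)" "bij_betw \<beta> (verts G) (verts G)"
    using assms by (simp_all add: automorphism_def)
  have "{u, v} \<in> edges G \<longleftrightarrow> {\<beta> (\<alpha> u), \<beta> (\<alpha> v)} \<in> edges G"
    if "u \<in> verts G" "v \<in> verts G" for u v
    using assms that bij_betw_apply[OF b(1)] unfolding automorphism_def by metis
  with bij_betw_trans[OF b] show ?thesis
    by (simp add: automorphism_def)
qed

lemma automorphism_inv:
  assumes "automorphism G \<alpha>"
  shows "automorphism G (inv_into (verts G) \<alpha>)"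
proof -
  have b: "bij_betw \<alpha> (verts G) (verts G)"
    using assms by (simp add: automorphism_def)
  have i: "inv_into (verts G) \<alpha> v \<in> verts G" "\<alpha> (inv_into (verts G) \<alpha> v) = v"
    if "v \<in> verts G" for v
    using b that by (auto simp: bij_betw_def inv_into_into f_inv_into_f)
  show ?thesis
    using assms b i by (simp add: automorphism_def bij_betw_inv_into)
qed

lemma equiv_coloring_equiv: "equiv (extensional (verts G)) (coloring_equiv G)"
proof (rule equivI)
  show "coloring_equiv G \<subseteq> extensional (verts G) \<times> extensional (verts G)"
    by (auto simp: coloring_equiv_def)
  show "refl_on (extensional (verts G)) (coloring_equiv G)"
    using automorphism_id by (fastforce simp: coloring_equiv_def refl_on_def)
  show "sym (coloring_equiv G)"
  proof (rule symI)
    fix c d assume "(c, d) \<in> coloring_equiv G"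
    then obtain \<alpha> where e: "c \<in> extensional (verts G)" "d \<in> extensional (verts G)"
      and a: "automorphism G \<alpha>" and eq: "\<And>v. v \<in> verts G \<Longrightarrow> c v = d (\<alpha> v)"
      by (auto simp: coloring_equiv_def)
    have "\<alpha> ` verts G = verts G"
      using a by (simp add: automorphism_def bij_betw_def)
    then have "d v = c (inv_into (verts G) \<alpha> v)" if "v \<in> verts G" for v
      using that eq by (metis inv_into_into f_inv_into_f)
    with e automorphism_inv[OF a] show "(d, c) \<in> coloring_equiv G"
      by (auto simp: coloring_equiv_def)
  qed
  show "trans (coloring_equiv G)"
  proof (rule transI)
    fix c d e assume "(c, d) \<in> coloring_equiv G" "(d, e) \<in> coloring_equiv G"
    then obtain \<alpha> \<beta> where ext: "c \<in> extensional (verts G)" "e \<in> extensional (verts G)"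
      and a: "automorphism G \<alpha>" "\<And>v. v \<in> verts G \<Longrightarrow> c v = d (\<alpha> v)"
      and b: "automorphism G \<beta>" "\<And>v. v \<in> verts G \<Longrightarrow> d v = e (\<beta> v)"
      by (auto simp: coloring_equiv_def)
    have "c v = e ((\<beta> \<circ> \<alpha>) v)" if "v \<in> verts G" for v
      using that a b bij_betw_apply[of \<alpha> "verts G" "verts G" v]
      unfolding automorphism_def by simp
    with ext automorphism_comp[OF a(1) b(1)] show "(c, e) \<in> coloring_equiv G"
      by (auto simp: coloring_equiv_def)
  qed
qed

end

theory Submission
  imports Defs "HOL-Combinatorics.Transposition"
begin

text \<open>Two vertices of \<open>K\<^sub>n\<^sub>,\<^sub>n\<close> are adjacent exactly if they lie on different sides, so the
  automorphisms are the permutations of the vertices that either keep both sides or exchange them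
  (\<open>automorphism_iff_side\<close>).

  Suppose a coloring is distinguishing. Then no two vertices of one side share a color, since
  exchanging them would be a color preserving automorphism. Hence the colors of each side form an
  \<open>n\<close>-set, and the two \<open>n\<close>-sets differ, since otherwise matching vertices of equal color across the
  sides would preserve colors. Conversely these two conditions leave only the identity
  (\<open>distinguishing_iff\<close>). Up to equivalence such a coloring is determined by the unordered pair of
  its two \<open>n\<close>-sets (\<open>coloring_equiv_iff\<close>), and all pairs of distinct \<open>n\<close>-subsets of the palette
  occur.

  So the classes number half as many as the ordered pairs \<open>(S, T)\<close> of distinct \<open>n\<close>-subsets
  (\<open>card_classes\<close>). Without further restriction there are \<open>N (N - 1)\<close> of these, where \<open>N\<close> is the
  number of \<open>n\<close>-subsets. If all \<open>k\<close> colors have to be used, then \<open>T\<close> must contain the \<open>k - n\<close> colors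
  outside \<open>S\<close>, which leaves the choice of the \<open>k - n\<close> colors of \<open>S\<close> that \<open>T\<close> omits; and \<open>S \<noteq> T\<close>
  is then automatic because \<open>k > n\<close>.\<close>

section \<open>Counting classes and unordered pairs\<close>

lemma card_quotient_eq_card_image:
  assumes r: "equiv X r" and A: "A \<subseteq> X"
    and f: "\<And>c d. c \<in> A \<Longrightarrow> d \<in> A \<Longrightarrow> (c, d) \<in> r \<longleftrightarrow> f c = f d"
  shows "card (A // r) = card (f ` A)"
proof -
  let ?h = "\<lambda>y. r `` {inv_into A f y}"
  have cls: "r `` {c} = r `` {d} \<longleftrightarrow> f c = f d" if "c \<in> A" "d \<in> A" for c d
    using eq_equiv_class_iff[OF r] A f that by blast
  have h: "?h (f c) = r `` {c}" if "c \<in> A" for c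
    using that by (subst cls) (auto intro: inv_into_into f_inv_into_f)
  have "inj_on ?h (f ` A)"
    by (rule inj_onI) (auto simp: h cls)
  moreover have "?h ` f ` A = A // r"
    using h by (auto simp: quotient_def image_image)
  ultimately show ?thesis
    using card_image by metis
qed

lemma card_ordered_pairs_eq:
  assumes fin: "finite E" and sym: "\<And>S T. (S, T) \<in> E \<Longrightarrow> (T, S) \<in> E"
    and irrefl: "\<And>S. (S, S) \<notin> E"
  shows "card E = 2 * card ((\<lambda>(S, T). {S, T}) ` E)"
proof -
  let ?g = "\<lambda>(S, T). {S, T}"
  have fibre: "card {e \<in> E. ?g e = P} = 2" if "P \<in> ?g ` E" for P
  proof -
    from that obtain S T where e: "(S, T) \<in> E" and P: "P = {S, T}"
      by auto
    with irrefl have "S \<noteq> T" by auto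
    moreover have "{e \<in> E. ?g e = P} = {(S, T), (T, S)}"
      using e sym P by (auto simp: doubleton_eq_iff)
    ultimately show ?thesis by simp
  qed
  have "card E = (\<Sum>P\<in>?g ` E. card {e \<in> E. ?g e = P})"
    using sum.image_gen[OF fin, of "\<lambda>_. 1 :: nat" ?g] by simp
  also have "\<dots> = 2 * card (?g ` E)"
    using fibre by simp
  finally show ?thesis .
qed

section \<open>Automorphisms of the complete bipartite graph\<close>

text \<open>Naming a side by a truth value makes exchanging the two sides the negation. Throughout,
  \<open>s = b\<close> is the side onto which \<open>s\<close> is mapped, so \<open>b = True\<close> keeps the sides and
  \<open>b = False\<close> exchanges them.\<close>

definition side :: "nat \<Rightarrow> bool \<Rightarrow> (nat + nat) set" where
  "side n s = {v \<in> {1..n} <+> {1..n}. isl v = s}"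

lemma side_True: "side n True = Inl ` {1..n}"
  and side_False: "side n False = Inr ` {1..n}"
  by (auto simp: side_def)

lemma finite_side: "finite (side n s)"
  by (cases s) (simp_all add: side_True side_False)

lemma card_side: "card (side n s) = n"
  by (cases s) (simp_all add: side_True side_False card_image)

lemma verts_complete_bipartite:
  "verts (complete_bipartite n n) = side n True \<union> side n False"
  by (auto simp: complete_bipartite_def side_def)

lemma in_verts_iff: "v \<in> verts (complete_bipartite n n) \<longleftrightarrow> v \<in> side n (isl v)"
  by (auto simp: complete_bipartite_def side_def)

lemma side_iff: "v \<in> side n s \<longleftrightarrow> v \<in> verts (complete_bipartite n n) \<and> isl v = s"
  by (auto simp: complete_bipartite_def side_def)

lemma edge_iff_isl:
  assumes "u \<in> verts (complete_bipartite n n)" "v \<in> verts (complete_bipartite n n)"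
  shows "{u, v} \<in> edges (complete_bipartite n n) \<longleftrightarrow> isl u \<noteq> isl v"
  using assms by (cases u; cases v) (auto simp: complete_bipartite_def doubleton_eq_iff)

text \<open>An automorphism preserves adjacency, that is, the relation of lying on different sides.
  With only two sides, the image of one vertex therefore decides where every other vertex goes.\<close>

lemma automorphism_iff_side:
  defines "G \<equiv> \<lambda>n. complete_bipartite n n"
  shows "automorphism (G n) \<alpha> \<longleftrightarrow>
    bij_betw \<alpha> (verts (G n)) (verts (G n)) \<and> (\<exists>b. \<forall>v\<in>verts (G n). isl (\<alpha> v) = (isl v = b))"
proof -
  have "(\<forall>u\<in>verts (G n). \<forall>v\<in>verts (G n).
          {u, v} \<in> edges (G n) \<longleftrightarrow> {\<alpha> u, \<alpha> v} \<in> edges (G n))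
        \<longleftrightarrow> (\<exists>b. \<forall>v\<in>verts (G n). isl (\<alpha> v) = (isl v = b))"
    (is "?L \<longleftrightarrow> ?R") if "bij_betw \<alpha> (verts (G n)) (verts (G n))"
  proof -
    have "?L \<longleftrightarrow> (\<forall>u\<in>verts (G n). \<forall>v\<in>verts (G n).
        isl u \<noteq> isl v \<longleftrightarrow> isl (\<alpha> u) \<noteq> isl (\<alpha> v))"
      using bij_betw_apply[OF that] unfolding G_def by (simp add: edge_iff_isl)
    also have "\<dots> \<longleftrightarrow> ?R"
    proof
      assume L: "\<forall>u\<in>verts (G n). \<forall>v\<in>verts (G n). isl u \<noteq> isl v \<longleftrightarrow> isl (\<alpha> u) \<noteq> isl (\<alpha> v)"
      show ?R
      proof (cases "verts (G n) = {}")
        case False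
        then obtain u where "u \<in> verts (G n)" by blast
        with L have "\<forall>v\<in>verts (G n). isl (\<alpha> v) = (isl v = (isl (\<alpha> u) = isl u))" by blast
        then show ?thesis by blast
      qed simp
    qed blast
    finally show ?thesis .
  qed
  then show ?thesis
    unfolding automorphism_def by blast
qed

lemma automorphism_image_side:
  assumes bij: "bij_betw \<alpha> (verts (complete_bipartite n n)) (verts (complete_bipartite n n))"
    and b: "\<And>v. v \<in> verts (complete_bipartite n n) \<Longrightarrow> isl (\<alpha> v) = (isl v = b)"
  shows "\<alpha> ` side n s = side n (s = b)"
proof (rule card_subset_eq)
  show "\<alpha> ` side n s \<subseteq> side n (s = b)"
    using bij_betw_apply[OF bij] b by (auto simp: side_iff)
  have "inj_on \<alpha> (side n s)"
    using bij by (auto simp: bij_betw_def side_iff inj_on_def)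
  then show "card (\<alpha> ` side n s) = card (side n (s = b))"
    by (simp add: card_image card_side)
qed (rule finite_side)

text \<open>When colors do not repeat within a side, matching equal colors is the only candidate for a
  color preserving map, and it is an automorphism as soon as the color sets of the sides agree,
  possibly after an exchange. This yields both the automorphisms that witness equivalence and,
  with \<open>c = d\<close>, the nontrivial symmetry of a coloring with equal color sets.\<close>

lemma ex_color_matching_automorphism:
  assumes injc: "\<And>s. inj_on c (side n s)" and injd: "\<And>s. inj_on d (side n s)"
    and img: "\<And>s. c ` side n s = d ` side n (s = b)"
  shows "\<exists>\<alpha>. automorphism (complete_bipartite n n) \<alpha> \<and>
    (\<forall>v\<in>verts (complete_bipartite n n). c v = d (\<alpha> v) \<and> isl (\<alpha> v) = (isl v = b))"
proof -
  let ?V = "verts (complete_bipartite n n)"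
  define \<alpha> where "\<alpha> v = inv_into (side n (isl v = b)) d (c v)" for v
  have mem: "c v \<in> d ` side n (isl v = b)" if "v \<in> ?V" for v
    using that img by (metis imageI in_verts_iff)
  have col: "d (\<alpha> v) = c v" if "v \<in> ?V" for v
    using mem[OF that] unfolding \<alpha>_def by (rule f_inv_into_f)
  have sd: "\<alpha> v \<in> side n (isl v = b)" if "v \<in> ?V" for v
    using mem[OF that] unfolding \<alpha>_def by (rule inv_into_into)
  then have isl: "isl (\<alpha> v) = (isl v = b)" if "v \<in> ?V" for v
    using that by (simp add: side_iff)
  have inj: "inj_on \<alpha> ?V"
  proof (rule inj_onI)
    fix u v assume uv: "u \<in> ?V" "v \<in> ?V" "\<alpha> u = \<alpha> v"
    then have "isl u = isl v" "c u = c v"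
      using isl col by metis+
    with uv injc[of "isl v"] show "u = v"
      by (auto simp: in_verts_iff dest: inj_onD)
  qed
  have "\<alpha> ` ?V \<subseteq> ?V"
    using sd by (auto simp: side_iff)
  moreover have "finite ?V"
    by (simp add: verts_complete_bipartite finite_side)
  ultimately have "bij_betw \<alpha> ?V ?V"
    using inj by (simp add: bij_betw_def endo_inj_surj)
  with isl col show ?thesis
    by (metis automorphism_iff_side)
qed

section \<open>Distinguishing colorings and their equivalence\<close>

lemma distinguishing_iff:
  assumes n: "n > 0"
  shows "distinguishing (complete_bipartite n n) c \<longleftrightarrow>
    (\<forall>s. inj_on c (side n s)) \<and> c ` side n True \<noteq> c ` side n False" (is "?D \<longleftrightarrow> ?C")
proof
  let ?V = "verts (complete_bipartite n n)"
  assume D: ?D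
  have inj: "inj_on c (side n s)" for s
  proof (rule inj_onI)
    fix u v assume u: "u \<in> side n s" and v: "v \<in> side n s" and eq: "c u = c v"
    have uv: "u \<in> ?V" "v \<in> ?V" "isl u = isl v"
      using u v by (auto simp: side_iff)
    let ?\<alpha> = "transpose u v"
    have "bij_betw ?\<alpha> ?V ?V"
      using uv by (intro bij_betw_byWitness[where f' = ?\<alpha>]) (auto simp: transpose_def)
    moreover have "\<forall>w\<in>?V. isl (?\<alpha> w) = (isl w = True)"
      using uv by (auto simp: transpose_def)
    ultimately have "automorphism (complete_bipartite n n) ?\<alpha>"
      by (metis automorphism_iff_side)
    moreover have "\<forall>w\<in>?V. c (?\<alpha> w) = c w"
      using eq by (auto simp: transpose_def)
    ultimately have "?\<alpha> u = u"
      using D uv unfolding distinguishing_def by blast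
    then show "u = v" by simp
  qed
  moreover have "c ` side n True \<noteq> c ` side n False"
  proof
    assume eq: "c ` side n True = c ` side n False"
    then have "c ` side n s = c ` side n (s = False)" for s
      by (cases s) simp_all
    from ex_color_matching_automorphism[OF inj inj this] obtain \<alpha>
      where "automorphism (complete_bipartite n n) \<alpha>"
        and \<alpha>: "\<forall>v\<in>?V. c v = c (\<alpha> v) \<and> isl (\<alpha> v) = (isl v = False)"
      by blast
    then have id: "\<forall>v\<in>?V. \<alpha> v = v"
      using D unfolding distinguishing_def by metis
    have "Inl 1 \<in> ?V"
      using n by (auto simp: complete_bipartite_def)
    with id \<alpha> show False by fastforce
  qed
  ultimately show ?C by blast
next
  let ?V = "verts (complete_bipartite n n)"
  assume C: ?C
  show ?D
    unfolding distinguishing_def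
  proof (intro allI impI ballI, elim conjE)
    fix \<alpha> v
    assume "automorphism (complete_bipartite n n) \<alpha>" and col: "\<forall>v\<in>?V. c (\<alpha> v) = c v"
      and v: "v \<in> ?V"
    then obtain b where bij: "bij_betw \<alpha> ?V ?V"
      and b: "\<And>v. v \<in> ?V \<Longrightarrow> isl (\<alpha> v) = (isl v = b)"
      using automorphism_iff_side by metis
    have "c ` side n True = c ` \<alpha> ` side n True"
      using col by (force simp: image_image side_iff)
    also have "\<dots> = c ` side n b"
      using automorphism_image_side[OF bij b] by simp
    finally have b: "isl (\<alpha> v) = isl v"
      using C b v by (cases b) auto
    moreover have "\<alpha> v \<in> ?V"
      using bij_betw_apply[OF bij v] .
    ultimately show "\<alpha> v = v"
      using C col v by (metis in_verts_iff inj_onD)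
  qed
qed

text \<open>Exchanging the sides is an automorphism, so a class remembers only the unordered pair.\<close>

definition color_sets :: "nat \<Rightarrow> (nat + nat \<Rightarrow> nat) \<Rightarrow> nat set set" where
  "color_sets n c = {c ` side n True, c ` side n False}"

lemma coloring_equiv_iff:
  assumes ext: "c \<in> extensional (verts (complete_bipartite n n))"
      "d \<in> extensional (verts (complete_bipartite n n))"
    and inj: "\<And>s. inj_on c (side n s)" "\<And>s. inj_on d (side n s)"
  shows "(c, d) \<in> coloring_equiv (complete_bipartite n n) \<longleftrightarrow> color_sets n c = color_sets n d"
proof
  let ?V = "verts (complete_bipartite n n)"
  assume "(c, d) \<in> coloring_equiv (complete_bipartite n n)"
  then obtain \<alpha> where "automorphism (complete_bipartite n n) \<alpha>"
    and col: "\<forall>v\<in>?V. c v = d (\<alpha> v)"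
    by (auto simp: coloring_equiv_def)
  then obtain b where bij: "bij_betw \<alpha> ?V ?V"
    and b: "\<And>v. v \<in> ?V \<Longrightarrow> isl (\<alpha> v) = (isl v = b)"
    using automorphism_iff_side by metis
  have "c ` side n s = d ` side n (s = b)" for s
  proof -
    have "c ` side n s = d ` \<alpha> ` side n s"
      using col by (force simp: image_image side_iff)
    then show ?thesis
      using automorphism_image_side[OF bij b] by simp
  qed
  then show "color_sets n c = color_sets n d"
    by (cases b) (auto simp: color_sets_def)
next
  assume "color_sets n c = color_sets n d"
  then obtain b where "\<And>s. c ` side n s = d ` side n (s = b)"
  proof (cases "c ` side n True = d ` side n True")
    case True
    with \<open>color_sets n c = color_sets n d\<close> have "c ` side n False = d ` side n False"
      unfolding color_sets_def by (metis doubleton_eq_iff)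
    with True have "c ` side n s = d ` side n (s = True)" for s
      by (cases s) simp_all
    then show ?thesis by (rule that)
  next
    case False
    with \<open>color_sets n c = color_sets n d\<close>
    have "c ` side n True = d ` side n False" "c ` side n False = d ` side n True"
      unfolding color_sets_def by (metis doubleton_eq_iff)+
    then have "c ` side n s = d ` side n (s = False)" for s
      by (cases s) simp_all
    then show ?thesis by (rule that)
  qed
  from ex_color_matching_automorphism[OF inj this] ext
  show "(c, d) \<in> coloring_equiv (complete_bipartite n n)"
    by (auto simp: coloring_equiv_def)
qed

lemma ex_coloring_with_color_sets:
  assumes "finite S" "card S = n" "finite T" "card T = n"
  shows "\<exists>c \<in> verts (complete_bipartite n n) \<rightarrow>\<^sub>E S \<union> T.
    (\<forall>s. inj_on c (side n s)) \<and> c ` side n True = S \<and> c ` side n False = T"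
proof -
  let ?V = "verts (complete_bipartite n n)"
  obtain f g where f: "bij_betw f {1..n} S" and g: "bij_betw g {1..n} T"
    using ex_bij_betw_nat_finite_1 assms by metis
  define c where "c = restrict (case_sum f g) ?V"
  have c: "c (Inl i) = f i" "c (Inr i) = g i" if "i \<in> {1..n}" for i
    using that by (auto simp: c_def complete_bipartite_def)
  have img: "c ` side n True = S" "c ` side n False = T"
    using f g c by (auto simp: side_True side_False image_image bij_betw_def)
  have "inj_on c (side n s)" for s
    by (rule eq_card_imp_inj_on) (use img assms in \<open>cases s; simp add: finite_side card_side\<close>)+
  moreover have "c ` ?V = S \<union> T"
    by (simp add: verts_complete_bipartite image_Un img)
  then have "c \<in> ?V \<rightarrow>\<^sub>E S \<union> T"
    by (auto simp: c_def)
  ultimately show ?thesis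
    using img by blast
qed

text \<open>The predicate \<open>Q\<close> on the set of used colors covers both counts: it is trivial for \<open>Phi\<close>, and
  demands the whole palette for \<open>phi\<close>.\<close>

lemma card_classes:
  fixes Q :: "nat set \<Rightarrow> bool" and k n :: nat
  assumes n: "n > 0"
  defines "F \<equiv> {S. S \<subseteq> {1..k} \<and> card S = n}"
  shows "2 * card ({c \<in> verts (complete_bipartite n n) \<rightarrow>\<^sub>E {1..k}.
            distinguishing (complete_bipartite n n) c \<and> Q (c ` verts (complete_bipartite n n))}
          // coloring_equiv (complete_bipartite n n))
    = card {(S, T). S \<in> F \<and> T \<in> F \<and> S \<noteq> T \<and> Q (S \<union> T)}"
    (is "2 * card (?A // _) = card ?E")
proof -
  let ?V = "verts (complete_bipartite n n)"
  have "color_sets n ` ?A = (\<lambda>(S, T). {S, T}) ` ?E"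
  proof (intro equalityI subsetI)
    fix P assume "P \<in> color_sets n ` ?A"
    then obtain c where "c \<in> ?A" and P: "P = color_sets n c"
      by blast
    then have c: "c \<in> ?V \<rightarrow>\<^sub>E {1..k}" and Q: "Q (c ` ?V)"
      and inj: "\<And>s. inj_on c (side n s)" and ne: "c ` side n True \<noteq> c ` side n False"
      unfolding distinguishing_iff[OF n] by blast+
    have "c ` side n s \<in> F" for s
      using c card_image[OF inj] unfolding F_def
      by (auto simp: side_iff card_side)
    with Q ne have E: "(c ` side n True, c ` side n False) \<in> ?E"
      by (simp add: verts_complete_bipartite image_Un)
    then show "P \<in> (\<lambda>(S, T). {S, T}) ` ?E"
      using P unfolding color_sets_def by (intro image_eqI[OF _ E]) simp
  next
    fix P assume "P \<in> (\<lambda>(S, T). {S, T}) ` ?E"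
    then obtain S T where ST: "S \<in> F" "T \<in> F" "S \<noteq> T" "Q (S \<union> T)" and P: "P = {S, T}"
      by auto
    have fin: "finite S" "finite T"
      using ST by (auto simp: F_def intro: finite_subset)
    obtain c where c: "c \<in> ?V \<rightarrow>\<^sub>E S \<union> T" and inj: "\<forall>s. inj_on c (side n s)"
      and img: "c ` side n True = S" "c ` side n False = T"
      using ex_coloring_with_color_sets[of S n T] ST fin by (auto simp: F_def)
    have "S \<union> T \<subseteq> {1..k}"
      using ST by (simp add: F_def)
    with c have "c \<in> ?V \<rightarrow>\<^sub>E {1..k}"
      using PiE_mono by blast
    moreover have "distinguishing (complete_bipartite n n) c"
      using inj img ST distinguishing_iff[OF n] by simp
    moreover have "Q (c ` ?V)"
      using ST by (simp add: verts_complete_bipartite image_Un img)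
    ultimately have "c \<in> ?A" by simp
    moreover have "P = color_sets n c"
      using P img by (simp add: color_sets_def)
    ultimately show "P \<in> color_sets n ` ?A" by blast
  qed
  moreover have "card (?A // coloring_equiv (complete_bipartite n n)) = card (color_sets n ` ?A)"
  proof (rule card_quotient_eq_card_image[OF equiv_coloring_equiv])
    show "?A \<subseteq> extensional ?V"
      by (auto simp: PiE_def)
    show "(c, d) \<in> coloring_equiv (complete_bipartite n n) \<longleftrightarrow> color_sets n c = color_sets n d"
      if "c \<in> ?A" "d \<in> ?A" for c d
      using that distinguishing_iff[OF n] by (intro coloring_equiv_iff) (auto simp: PiE_def)
  qed
  moreover have "card ?E = 2 * card ((\<lambda>(S, T). {S, T}) ` ?E)"
  proof (rule card_ordered_pairs_eq)
    have "finite F" by (simp add: F_def)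
    then show "finite ?E"
      by (rule_tac finite_subset[of _ "F \<times> F"]) auto
  qed (auto simp: Un_commute)
  ultimately show ?thesis by simp
qed

section \<open>Counting pairs of color sets\<close>

lemma card_distinct_pairs:
  assumes "finite F"
  shows "card {(S, T). S \<in> F \<and> T \<in> F \<and> S \<noteq> T} = card F * (card F - 1)"
proof -
  have "{(S, T). S \<in> F \<and> T \<in> F \<and> S \<noteq> T} = (SIGMA S:F. F - {S})" by auto
  then show ?thesis
    using assms by (simp add: card_SigmaI)
qed

text \<open>A set that covers the rest of \<open>U\<close> is determined by the part of \<open>S\<close> that it omits.\<close>

lemma card_complementing_subsets:
  assumes U: "finite U" and S: "S \<subseteq> U" "card S = n"
  shows "card {T. T \<subseteq> U \<and> card T = n \<and> S \<union> T = U} = n choose (card U - n)"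
proof -
  have fin: "finite S"
    using S U finite_subset by blast
  have n: "n \<le> card U"
    using S U card_mono by blast
  have cardU: "card (U - R) = card U - card R" if "R \<subseteq> S" for R
    using that S U fin by (meson card_Diff_subset finite_subset subset_trans)
  have "bij_betw (\<lambda>R. U - R) {R. R \<subseteq> S \<and> card R = card U - n}
      {T. T \<subseteq> U \<and> card T = n \<and> S \<union> T = U}"
  proof (rule bij_betw_byWitness[where f' = "\<lambda>T. U - T"])
    show "(\<lambda>R. U - R) ` {R. R \<subseteq> S \<and> card R = card U - n}
        \<subseteq> {T. T \<subseteq> U \<and> card T = n \<and> S \<union> T = U}"
      using S n cardU by auto
    show "(\<lambda>T. U - T) ` {T. T \<subseteq> U \<and> card T = n \<and> S \<union> T = U}
        \<subseteq> {R. R \<subseteq> S \<and> card R = card U - n}"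
      using U by (auto simp: card_Diff_subset finite_subset)
  qed (use S in auto)
  from bij_betw_same_card[OF this] show ?thesis
    using n_subsets[OF fin] S by simp
qed

lemma card_covering_pairs:
  assumes U: "finite U" and k: "n < card U"
  shows "card {(S, T). S \<in> {S. S \<subseteq> U \<and> card S = n} \<and> T \<in> {S. S \<subseteq> U \<and> card S = n} \<and>
      S \<noteq> T \<and> S \<union> T = U} = (card U choose n) * (n choose (card U - n))" (is "card ?E = _")
proof -
  let ?F = "{S. S \<subseteq> U \<and> card S = n}"
  have "?E = (SIGMA S:?F. {T. T \<subseteq> U \<and> card T = n \<and> S \<union> T = U})"
    using k by auto
  also have "card \<dots> = (\<Sum>S\<in>?F. card {T. T \<subseteq> U \<and> card T = n \<and> S \<union> T = U})"
    using U by (intro card_SigmaI) auto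
  also have "\<dots> = (\<Sum>S\<in>?F. n choose (card U - n))"
    using U by (intro sum.cong refl card_complementing_subsets) auto
  finally show ?thesis
    using n_subsets[OF U] by simp
qed

section \<open>The two counts\<close>

theorem theorem2p3:
  fixes n :: nat
  assumes "n \<ge> 2"
  shows "(\<forall>k::nat. k \<ge> 1 \<longrightarrow>
            real (Phi k (complete_bipartite n n)) =
              1 / 2 * real (k choose n) * (real (k choose n) - 1)) \<and>
         (\<forall>k::nat. n + 1 \<le> k \<and> k \<le> 2 * n \<longrightarrow>
            real (phi k (complete_bipartite n n)) =
              1 / 2 * real (k choose n) * real (n choose (k - n)))"
proof (intro conjI allI impI)
  have n: "n > 0" using assms by simp
  fix k :: nat
  let ?N = "k choose n"
  have "2 * Phi k (complete_bipartite n n) = ?N * (?N - 1)"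
    using card_classes[OF n, of k "\<lambda>_. True"] card_distinct_pairs[of "{S. S \<subseteq> {1..k} \<and> card S = n}"]
      n_subsets[of "{1..k}" n]
    by (simp add: Phi_def)
  then have "2 * real (Phi k (complete_bipartite n n)) = real (?N * (?N - 1))"
    by (metis of_nat_mult of_nat_numeral)
  also have "\<dots> = real ?N * (real ?N - 1)"
    by (cases ?N) (simp_all add: algebra_simps)
  finally show "real (Phi k (complete_bipartite n n)) = 1 / 2 * real ?N * (real ?N - 1)"
    by simp
next
  have n: "n > 0" using assms by simp
  fix k :: nat
  assume k: "n + 1 \<le> k \<and> k \<le> 2 * n"
  have "2 * phi k (complete_bipartite n n) = (k choose n) * (n choose (k - n))"
    using card_classes[OF n, of k "\<lambda>X. X = {1..k}"] card_covering_pairs[of "{1..k}" n] k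
    by (simp add: phi_def)
  then have "2 * real (phi k (complete_bipartite n n)) =
      real (k choose n) * real (n choose (k - n))"
    by (metis of_nat_mult of_nat_numeral)
  then show "real (phi k (complete_bipartite n n)) =
      1 / 2 * real (k choose n) * real (n choose (k - n))"
    by simp
qed

end
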